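(* Let $X$ be a real Hilbert space, let $I=\{1,\dots,m\}$ with $m\ge 1$, and for each $i\in I$ let $f_i\colon X\to\mathbb{R}$ be convex and continuous. Let $C:=\{x\in X : f_i(x)\le 0 \text{ for all } i\in I\}$ be nonempty, and let $L>0$ be such that $\|u\|\le L$ for all $i\in I$, $x\in X$ and $u\in\partial f_i(x)$. Suppose $s\in X$ satisfies $\max_{i\in I} f_i(s)<0$ and set $\sigma:=\min_{i\in I}(-f_i(s))>0$. Let $\alpha$ be a real number with $0<\alpha<\frac{2\sigma}{L^2}$, and let $\alpha_k:=\alpha$ for every $k\in\mathbb{N}$. Then, for every starting point $x_0\in X$ and every choice of violated indices and subgradients, the subgradient algorithm with constant step sizes $\alpha_k=\alpha$ finds a point in $C$ after finitely many steps, i.e., there is $K\in\mathbb{N}$ such that the iterate $x_K$ is generated and $x_K\in C$.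
   Context: $\mathbb{N}=\{0,1,2,\dots\}$. The convex subdifferential of $f\colon X\to\mathbb{R}$ at $x$ is $\partial f(x)=\{u\in X : f(x)+\langle y-x,u\rangle\le f(y)\text{ for all }y\in X\}$. Subgradient algorithm: given step sizes $(\alpha_k)_{k\in\mathbb{N}}$ in $[0,+\infty[$ and a starting point $x_0\in X$, proceed as follows for $k=0,1,2,\dots$. If $x_k\in C$, stop. Otherwise, pick any index $i_k\in I$ with $f_{i_k}(x_k)>0$ and any $g_k\in\partial f_{i_k}(x_k)$, and set $x_{k+1}:=x_k-\alpha_kg_k$. *)

theory Defs
  imports "HOL-Analysis.Analysis"
begin

definition subdifferential :: "('a::real_inner \<Rightarrow> real) \<Rightarrow> 'a \<Rightarrow> 'a set" where
  "subdifferential f x = {u. \<forall>y. f x + (y - x) \<bullet> u \<le> f y}"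

definition feasible_set :: "'i set \<Rightarrow> ('i \<Rightarrow> 'a \<Rightarrow> real) \<Rightarrow> 'a set" where
  "feasible_set I f = {x. \<forall>i\<in>I. f i x \<le> 0}"

text \<open>
  A run of the subgradient algorithm is a sequence of optional iterates: \<open>xs k = Some x\<close> means that
  the \<open>k\<close>-th iterate is generated and equals \<open>x\<close>, and \<open>xs k = None\<close> means that the algorithm has
  stopped before generating it. The only way to stop is to reach the feasible set. The violated
  index and the subgradient chosen in each step are arbitrary; quantifying over all runs is
  quantifying over all such choices.
\<close>
definition subgradient_run ::
  "'i set \<Rightarrow> ('i \<Rightarrow> 'a::real_inner \<Rightarrow> real) \<Rightarrow> (nat \<Rightarrow> real) \<Rightarrow> 'a \<Rightarrow> (nat \<Rightarrow> 'a option) \<Rightarrow> bool" where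
  "subgradient_run I f \<alpha> x0 xs \<longleftrightarrow>
     (\<forall>k. 0 \<le> \<alpha> k) \<and>
     xs 0 = Some x0 \<and>
     (\<forall>k. case xs k of
            None \<Rightarrow> xs (Suc k) = None
          | Some x \<Rightarrow>
              if x \<in> feasible_set I f then xs (Suc k) = None
              else \<exists>i\<in>I. f i x > 0 \<and>
                     (\<exists>g\<in>subdifferential (f i) x. xs (Suc k) = Some (x - \<alpha> k *\<^sub>R g)))"

end

theory Submission
  imports Defs
begin

text \<open>
  The proof follows the squared distance from the iterates to the Slater point \<open>s\<close>. At an infeasible
  \<open>x\<close> with violated constraint \<open>h\<close>, the subgradient inequality tested at \<open>s\<close> says that the
  step direction \<open>- g\<close> makes an inner product of at least \<open>h x - h s \<ge> \<sigma>\<close> with \<open>s - x\<close>: since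
  \<open>s\<close> satisfies the constraint with slack \<open>\<sigma>\<close>, each step aims at \<open>s\<close> with a uniform margin.
  Expanding the square, this gain \<open>2 * \<alpha> * \<sigma>\<close> beats the overshoot \<open>\<alpha>\<^sup>2 * L\<^sup>2\<close> exactly when
  \<open>\<alpha> < 2 * \<sigma> / L\<^sup>2\<close>. Every step at an infeasible point thus lowers the squared distance by at least
  a fixed positive amount, which can happen only finitely often, and a run can stop only
  at a feasible point.
\<close>

text \<open>
  Of the inner product \<open>(x - s) \<bullet> g \<ge> h x - h s\<close> only the slack of \<open>s\<close> is kept: the violation \<open>h x\<close>
  may be arbitrarily small, so it contributes nothing uniform. This leaves the gain \<open>2 * \<alpha> * \<sigma>\<close>
  against the quadratic term \<open>\<alpha>\<^sup>2 * (norm g)\<^sup>2\<close> of the expanded square.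
\<close>
lemma subgradient_step_norm_diff_le:
  fixes x s g :: "'a::real_inner"
  assumes g: "g \<in> subdifferential h x"
    and "h s \<le> - \<sigma>" and "0 \<le> h x" and "norm g \<le> L" and "0 \<le> \<alpha>"
  shows "(norm (x - \<alpha> *\<^sub>R g - s))\<^sup>2 \<le> (norm (x - s))\<^sup>2 - \<alpha> * (2 * \<sigma> - \<alpha> * L\<^sup>2)"
proof -
  have "h x + (s - x) \<bullet> g \<le> h s"
    using g by (auto simp: subdifferential_def)
  hence "\<sigma> \<le> (x - s) \<bullet> g"
    using assms(2,3) by (simp add: inner_diff_left)
  hence gain: "\<alpha> * \<sigma> \<le> \<alpha> * ((x - s) \<bullet> g)"
    using \<open>0 \<le> \<alpha>\<close> by (rule mult_left_mono)
  have loss: "\<alpha>\<^sup>2 * (norm g)\<^sup>2 \<le> \<alpha>\<^sup>2 * L\<^sup>2"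
    using \<open>norm g \<le> L\<close> by (intro mult_left_mono power_mono) auto
  have "(norm ((x - s) - \<alpha> *\<^sub>R g))\<^sup>2
      = (norm (x - s))\<^sup>2 - 2 * (\<alpha> * ((x - s) \<bullet> g)) + \<alpha>\<^sup>2 * (norm g)\<^sup>2"
    unfolding power2_norm_eq_inner
    by (simp add: inner_diff_left inner_diff_right inner_commute power2_eq_square algebra_simps)
  moreover have "x - \<alpha> *\<^sub>R g - s = (x - s) - \<alpha> *\<^sub>R g"
    by simp
  ultimately show ?thesis
    using gain loss by (simp add: algebra_simps power2_eq_square)
qed

text \<open>
  The squared distance to \<open>s\<close> is nonnegative, so it cannot decrease by a fixed positive amount
  forever; but a run that avoids the feasible set never stops.
\<close>
lemma subgradient_run_reaches_feasible_set:
  fixes f :: "'i \<Rightarrow> 'a::real_inner \<Rightarrow> real"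
  assumes run: "subgradient_run I f (\<lambda>k. \<alpha>) x0 xs"
    and slack: "\<And>i. i \<in> I \<Longrightarrow> f i s \<le> - \<sigma>"
    and bound: "\<And>i x u. i \<in> I \<Longrightarrow> u \<in> subdifferential (f i) x \<Longrightarrow> norm u \<le> L"
    and "0 < \<alpha>" and "\<alpha> * L\<^sup>2 < 2 * \<sigma>"
  shows "\<exists>K x. xs K = Some x \<and> x \<in> feasible_set I f"
proof (rule ccontr)
  assume "\<not> ?thesis"
  hence infeasible: "x \<notin> feasible_set I f" if "xs k = Some x" for k x
    using that by blast
  define \<delta> where "\<delta> = \<alpha> * (2 * \<sigma> - \<alpha> * L\<^sup>2)"
  have "0 < \<delta>"
    using assms(4,5) by (simp add: \<delta>_def)
  have decrease: "\<exists>x. xs k = Some x \<and> (norm (x - s))\<^sup>2 \<le> (norm (x0 - s))\<^sup>2 - real k * \<delta>" for k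
  proof (induction k)
    case 0
    show ?case
      using run by (simp add: subgradient_run_def)
  next
    case (Suc k)
    then obtain x where x: "xs k = Some x"
      and le: "(norm (x - s))\<^sup>2 \<le> (norm (x0 - s))\<^sup>2 - real k * \<delta>"
      by blast
    have "case xs k of
            None \<Rightarrow> xs (Suc k) = None
          | Some x \<Rightarrow>
              if x \<in> feasible_set I f then xs (Suc k) = None
              else \<exists>i\<in>I. f i x > 0 \<and>
                     (\<exists>g\<in>subdifferential (f i) x. xs (Suc k) = Some (x - \<alpha> *\<^sub>R g))"
      using run unfolding subgradient_run_def by blast
    then obtain i g where i: "i \<in> I" "f i x > 0" and g: "g \<in> subdifferential (f i) x"
      and next_iterate: "xs (Suc k) = Some (x - \<alpha> *\<^sub>R g)"
      using x infeasible[OF x] by auto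
    have "(norm (x - \<alpha> *\<^sub>R g - s))\<^sup>2 \<le> (norm (x - s))\<^sup>2 - \<delta>"
      unfolding \<delta>_def
      using subgradient_step_norm_diff_le[OF g slack[OF i(1)]] i(2) bound[OF i(1) g] \<open>0 < \<alpha>\<close>
      by simp
    with le have "(norm (x - \<alpha> *\<^sub>R g - s))\<^sup>2 \<le> (norm (x0 - s))\<^sup>2 - real (Suc k) * \<delta>"
      by (simp add: algebra_simps)
    with next_iterate show ?case
      by blast
  qed
  obtain n where "(norm (x0 - s))\<^sup>2 < real n * \<delta>"
    using reals_Archimedean3[OF \<open>0 < \<delta>\<close>] by blast
  moreover obtain x where "(norm (x - s))\<^sup>2 \<le> (norm (x0 - s))\<^sup>2 - real n * \<delta>"
    using decrease by blast
  ultimately show False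
    using zero_le_power2[of "norm (x - s)"] by linarith
qed

theorem corollary2p4:
  fixes f :: "nat \<Rightarrow> 'a::{real_inner, complete_space} \<Rightarrow> real"
    and m :: nat and L \<sigma> \<alpha> :: real and s :: 'a
  assumes "m \<ge> 1"
    and "\<And>i. i \<in> {1..m} \<Longrightarrow> convex_on UNIV (f i)"
    and "\<And>i. i \<in> {1..m} \<Longrightarrow> continuous_on UNIV (f i)"
    and "feasible_set {1..m} f \<noteq> {}"
    and "L > 0"
    and "\<And>i x u. i \<in> {1..m} \<Longrightarrow> u \<in> subdifferential (f i) x \<Longrightarrow> norm u \<le> L"
    and "(MAX i\<in>{1..m}. f i s) < 0"
    and "\<sigma> = (MIN i\<in>{1..m}. - f i s)"
    and "0 < \<alpha>" and "\<alpha> < 2 * \<sigma> / L\<^sup>2"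
  shows "\<forall>x0 xs. subgradient_run {1..m} f (\<lambda>k. \<alpha>) x0 xs \<longrightarrow>
           (\<exists>K x. xs K = Some x \<and> x \<in> feasible_set {1..m} f)"
proof (intro allI impI)
  fix x0 xs
  assume run: "subgradient_run {1..m} f (\<lambda>k. \<alpha>) x0 xs"
  have slack: "f i s \<le> - \<sigma>" if "i \<in> {1..m}" for i
  proof -
    have "\<sigma> \<le> - f i s"
      unfolding assms(8) using that by (intro Min_le) auto
    thus ?thesis by simp
  qed
  have "\<alpha> * L\<^sup>2 < 2 * \<sigma>"
    using assms(5,10) by (simp add: pos_less_divide_eq)
  with run slack assms(6,9) show "\<exists>K x. xs K = Some x \<and> x \<in> feasible_set {1..m} f"
    by (intro subgradient_run_reaches_feasible_set[where s = s])
qed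

end
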